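(* Let $(X,Y)$ be a random pair with $X\in\mathbb{R}^q$, $Y\in\mathbb{R}^p$, and let $(x_1,y_1),\dots,(x_n,y_n)$, $n\ge4$, be an iid sample of $(X,Y)$. Let $\kappa_X:\mathbb{R}^q\times\mathbb{R}^q\to\mathbb{R}$ and $\kappa_Y:\mathbb{R}^p\times\mathbb{R}^p\to\mathbb{R}$ be Mercer kernels whose induced distance functions $d_{\kappa_X}$ and $d_{\kappa_Y}$ both take values in $[0,1)$. Then for every $\epsilon>0$, $$\Pr\left[\mathrm{dCov}_{\kappa_X,\kappa_Y}^n-\mathrm{dCov}_{\kappa_X,\kappa_Y}(X,Y)\ge\epsilon\right]\le\exp\left(\frac{-n\epsilon^2}{512}\right)$$ and $$\Pr\left[\mathrm{dCov}_{\kappa_X,\kappa_Y}(X,Y)-\mathrm{dCov}_{\kappa_X,\kappa_Y}^n\ge\epsilon\right]\le\exp\left(\frac{-n\epsilon^2}{512}\right).$$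
   Context: A Mercer kernel is a continuous, symmetric, positive (semi)definite function $\kappa$; it induces $d_\kappa(x,x')=\sqrt{\kappa(x,x)+\kappa(x',x')-2\kappa(x,x')}$. The generalized distance covariance is, with $(X',Y')$ an independent copy of $(X,Y)$, $$\mathrm{dCov}_{\kappa_X,\kappa_Y}(X,Y)=\mathbb{E}\,d_{\kappa_X}(X,X')d_{\kappa_Y}(Y,Y')+\mathbb{E}d_{\kappa_X}(X,X')\,\mathbb{E}d_{\kappa_Y}(Y,Y')-2\,\mathbb{E}\left[\mathbb{E}_{X'}d_{\kappa_X}(X,X')\,\mathbb{E}_{Y'}d_{\kappa_Y}(Y,Y')\right].$$ Its estimator is $$\mathrm{dCov}_{\kappa_X,\kappa_Y}^n=\frac{1}{n(n-3)}\sum_{i\ne j}A_{ij}B_{ij},$$ where, with $a_{ij}=d_{\kappa_X}(x_i,x_j)$, $a_{i\cdot}=\sum_{j=1}^na_{ij}$, $a_{\cdot j}=\sum_{i=1}^na_{ij}$, $a_{\cdot\cdot}=\sum_{i,j=1}^na_{ij}$, $$A_{ij}=a_{ij}-\frac{1}{n-2}a_{i\cdot}-\frac1{n-2}a_{\cdot j}+\frac{1}{(n-1)(n-2)}a_{\cdot\cdot}\quad(i\ne j),\qquad A_{ii}=0,$$ and $B_{ij}$ is defined in the same way from $b_{ij}=d_{\kappa_Y}(y_i,y_j)$. *)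

theory Defs
  imports "HOL-Probability.Probability"
begin

definition mercer_kernel :: "('a::topological_space \<Rightarrow> 'a \<Rightarrow> real) \<Rightarrow> bool" where
  "mercer_kernel \<kappa> \<longleftrightarrow>
     continuous_on UNIV (\<lambda>(s, t). \<kappa> s t) \<and>
     (\<forall>s t. \<kappa> s t = \<kappa> t s) \<and>
     (\<forall>(m::nat) (z::nat \<Rightarrow> 'a) (c::nat \<Rightarrow> real).
        0 \<le> (\<Sum>i<m. \<Sum>j<m. c i * c j * \<kappa> (z i) (z j)))"

definition kernel_dist :: "('a \<Rightarrow> 'a \<Rightarrow> real) \<Rightarrow> 'a \<Rightarrow> 'a \<Rightarrow> real" where
  "kernel_dist \<kappa> s t = sqrt (\<kappa> s s + \<kappa> t t - 2 * \<kappa> s t)"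

(* The independent copy (X', Y') of (X, Y) is realised on the second factor of the product
   space M \<Otimes>\<^sub>M M, on whose first factor (X, Y) itself lives: X = X v and X' = X w. *)
definition dCov ::
  "'w measure \<Rightarrow> ('a \<Rightarrow> 'a \<Rightarrow> real) \<Rightarrow> ('b \<Rightarrow> 'b \<Rightarrow> real) \<Rightarrow> ('w \<Rightarrow> 'a) \<Rightarrow> ('w \<Rightarrow> 'b) \<Rightarrow> real" where
  "dCov M \<kappa>X \<kappa>Y X Y =
     (LINT (v, w)|(M \<Otimes>\<^sub>M M). kernel_dist \<kappa>X (X v) (X w) * kernel_dist \<kappa>Y (Y v) (Y w))
     + (LINT (v, w)|(M \<Otimes>\<^sub>M M). kernel_dist \<kappa>X (X v) (X w))
       * (LINT (v, w)|(M \<Otimes>\<^sub>M M). kernel_dist \<kappa>Y (Y v) (Y w))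
     - 2 * (LINT v|M. (LINT w|M. kernel_dist \<kappa>X (X v) (X w))
                      * (LINT w|M. kernel_dist \<kappa>Y (Y v) (Y w)))"

definition u_centered :: "nat \<Rightarrow> (nat \<Rightarrow> nat \<Rightarrow> real) \<Rightarrow> nat \<Rightarrow> nat \<Rightarrow> real" where
  "u_centered n a i j =
     (if i = j then 0
      else a i j
           - 1 / (real n - 2) * (\<Sum>l=1..n. a i l)
           - 1 / (real n - 2) * (\<Sum>k=1..n. a k j)
           + 1 / ((real n - 1) * (real n - 2)) * (\<Sum>k=1..n. \<Sum>l=1..n. a k l))"

definition dCov_est ::
  "nat \<Rightarrow> ('a \<Rightarrow> 'a \<Rightarrow> real) \<Rightarrow> ('b \<Rightarrow> 'b \<Rightarrow> real) \<Rightarrow> (nat \<Rightarrow> 'a) \<Rightarrow> (nat \<Rightarrow> 'b) \<Rightarrow> real" where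
  "dCov_est n \<kappa>X \<kappa>Y x y =
     1 / (real n * (real n - 3)) *
     (\<Sum>i=1..n. \<Sum>j\<in>{1..n} - {i}.
        u_centered n (\<lambda>k l. kernel_dist \<kappa>X (x k) (x l)) i j
        * u_centered n (\<lambda>k l. kernel_dist \<kappa>Y (y k) (y l)) i j)"

end

(* The estimator is the average, over all permutations p of the sample, of
     h (z_p(1), z_p(2), z_p(3), z_p(4)),  h = a12 b12 + a12 b34 - 2 a12 b13,
   a kernel with values in [-2, 2] and expectation dCov(X, Y).  As in Hoeffding's treatment of
   U-statistics, cutting the permuted sample into n div 4 disjoint blocks writes the estimator as
   an average over p of means of n div 4 independent copies of h.  Jensen's inequality moves the
   outer average out of the exponential moment, so the Chernoff bound of a single such mean applies.
   This gives exp (- 2 (n div 4) eps^2 / 16), and n div 4 >= n / 7 for n >= 4 leaves room to spare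
   below the constant 512. *)

theory Submission
  imports Defs
begin

text \<open>The obstacle is that the estimator is not visibly an average of \<open>h\<close>: every
  \<open>A_ij\<close> contains two full row sums and the grand total, so each summand depends on the
  whole sample. The bridge consists of three statistics: the sum P of \<open>a_ij b_ij\<close>, the
  sum S of the products of row sums, and the product T of the two grand totals. Expanding the
  U-centering expresses the estimator in P, S and T; counting coincidences among indices expresses
  the sum of \<open>h\<close> over distinct quadruples in the same three, and the coefficients
  agree. The summands of \<open>h\<close> mirror those of dCov: both distances on one pair, on two
  disjoint pairs, and on two pairs sharing an observation. Disjoint pairs use four observations,
  hence blocks of length four. Permutations fit a kernel that is not symmetric in its arguments, and
  a single permutation places all blocks at once.\<close>

section \<open>Hoeffding's inequality for an average of sample means\<close>

text \<open>Independence is required only along \<open>k\<close> for each fixed \<open>s\<close>.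
  Different \<open>s\<close> may be dependent in any way, and \<open>card S\<close> does not enter
  the bound.\<close>

lemma (in prob_space) Hoeffding_ineq_average:
  fixes W :: "'s \<Rightarrow> 'k \<Rightarrow> 'a \<Rightarrow> real" and \<mu> \<epsilon> a b :: real
  assumes S: "finite S" "S \<noteq> {}" and K: "finite K" "K \<noteq> {}"
    and indep: "\<And>s. s \<in> S \<Longrightarrow> indep_vars (\<lambda>_. borel) (W s) K"
    and bnd: "\<And>s k. s \<in> S \<Longrightarrow> k \<in> K \<Longrightarrow> AE x in M. W s k x \<in> {a..b}"
    and mean: "\<And>s k. s \<in> S \<Longrightarrow> k \<in> K \<Longrightarrow> expectation (W s k) = \<mu>"
    and "\<epsilon> > 0" "a < b"
  shows "prob {x \<in> space M. (\<Sum>s\<in>S. (\<Sum>k\<in>K. W s k x) / card K) / card S \<ge> \<mu> + \<epsilon>}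
           \<le> exp (- 2 * card K * \<epsilon>\<^sup>2 / (b - a)\<^sup>2)"
proof -
  define m where "m = real (card K)"
  define c where "c = real (card S)"
  define d where "d = b - a"
  \<comment> \<open>The minimiser of the exponent
    \<open>l\<^sup>2 * d\<^sup>2 / (8 * m) - l * \<epsilon>\<close> that the Chernoff bound
    produces; its minimum is \<open>- 2 * m * \<epsilon>\<^sup>2 / d\<^sup>2\<close>.\<close>
  define l where "l = 4 * m * \<epsilon> / d\<^sup>2"
  define V where "V = (\<lambda>s x. (\<Sum>k\<in>K. W s k x) / m)"
  have pos: "m > 0" "c > 0" "d > 0"
    using S K \<open>a < b\<close> by (auto simp: m_def c_def d_def card_gt_0_iff)
  then have "l > 0" using \<open>\<epsilon> > 0\<close> by (simp add: l_def)
  have W[measurable]: "W s k \<in> borel_measurable M" if "s \<in> S" "k \<in> K" for s k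
    using indep[OF that(1)] that(2) by (auto simp: indep_vars_def)
  have V[measurable]: "V s \<in> borel_measurable M" if "s \<in> S" for s
    unfolding V_def using that by measurable
  \<comment> \<open>Exponential moments are nonnegative integrals, so measurability suffices and no
    integrability has to be carried along. Each of the \<open>m\<close> independent factors has
    parameter \<open>l / m\<close>.\<close>
  have mgf: "(\<integral>\<^sup>+x. ennreal (exp (l * (V s x - \<mu>))) \<partial>M) \<le> ennreal (exp (l\<^sup>2 * d\<^sup>2 / (8 * m)))"
    if s: "s \<in> S" for s
  proof -
    have "l * (V s x - \<mu>) = (\<Sum>k\<in>K. (l / m) * (W s k x - \<mu>))" for x
    proof -
      have "(\<Sum>k\<in>K. (l / m) * (W s k x - \<mu>)) = (l / m) * ((\<Sum>k\<in>K. W s k x) - m * \<mu>)"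
        unfolding sum_distrib_left[symmetric] by (simp add: sum_subtractf m_def)
      then show ?thesis using pos(1) by (simp add: V_def field_simps)
    qed
    then have "(\<integral>\<^sup>+x. ennreal (exp (l * (V s x - \<mu>))) \<partial>M)
        = (\<integral>\<^sup>+x. (\<Prod>k\<in>K. ennreal (exp ((l / m) * (W s k x - \<mu>)))) \<partial>M)"
      using K by (simp add: exp_sum prod_ennreal)
    also have "\<dots> = (\<Prod>k\<in>K. \<integral>\<^sup>+x. ennreal (exp ((l / m) * (W s k x - \<mu>))) \<partial>M)"
      by (intro indep_vars_nn_integral K indep_vars_compose2[OF indep[OF s]]) auto
    also have "\<dots> \<le> (\<Prod>k\<in>K. ennreal (exp ((l / m)\<^sup>2 * d\<^sup>2 / 8)))"
    proof (intro prod_mono_ennreal)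
      fix k assume k: "k \<in> K"
      interpret interval_bounded_random_variable M "W s k" a b
        by unfold_locales (use bnd[OF s k] W[OF s k] in auto)
      show "(\<integral>\<^sup>+x. ennreal (exp ((l / m) * (W s k x - \<mu>))) \<partial>M)
              \<le> ennreal (exp ((l / m)\<^sup>2 * d\<^sup>2 / 8))"
        using Hoeffdings_lemma_nn_integral[of "l / m"] \<open>l > 0\<close> pos mean[OF s k]
        by (simp add: d_def)
    qed
    also have "\<dots> = ennreal (exp (m * ((l / m)\<^sup>2 * d\<^sup>2 / 8)))"
      unfolding m_def exp_of_nat_mult by (simp add: ennreal_power)
    also have "m * ((l / m)\<^sup>2 * d\<^sup>2 / 8) = l\<^sup>2 * d\<^sup>2 / (8 * m)"
      using pos by (simp add: field_simps power2_eq_square)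
    finally show ?thesis .
  qed
  have jensen: "exp (l * ((\<Sum>s\<in>S. V s x) / c - \<mu>)) \<le> (\<Sum>s\<in>S. exp (l * (V s x - \<mu>))) / c" for x
  proof -
    have *: "exp (l * (\<Sum>s\<in>S. (1 / c) *\<^sub>R (V s x - \<mu>))) \<le> (\<Sum>s\<in>S. (1 / c) * exp (l * (V s x - \<mu>)))"
      using S pos \<open>l > 0\<close> by (intro convex_on_sum[OF _ _ convex_on_exp]) (auto simp: c_def)
    have "(\<Sum>s\<in>S. (1 / c) *\<^sub>R (V s x - \<mu>)) = (\<Sum>s\<in>S. V s x) / c - \<mu>"
      using pos by (simp add: c_def sum_subtractf diff_divide_distrib flip: sum_divide_distrib)
    then show ?thesis
      using * unfolding sum_distrib_left[symmetric] by simp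
  qed
  have "{x \<in> space M. (\<Sum>s\<in>S. (\<Sum>k\<in>K. W s k x) / card K) / card S \<ge> \<mu> + \<epsilon>}
      = {x \<in> space M. (\<Sum>s\<in>S. V s x) / c - \<mu> \<ge> \<epsilon>}"
    by (auto simp: V_def c_def m_def)
  then have "ennreal (prob {x \<in> space M. (\<Sum>s\<in>S. (\<Sum>k\<in>K. W s k x) / card K) / card S \<ge> \<mu> + \<epsilon>})
      = emeasure M {x \<in> space M. (\<Sum>s\<in>S. V s x) / c - \<mu> \<ge> \<epsilon>}"
    by (simp add: emeasure_eq_measure)
  also have "\<dots> \<le> ennreal (exp (- l * \<epsilon>))
      * (\<integral>\<^sup>+x. ennreal (exp (l * ((\<Sum>s\<in>S. V s x) / c - \<mu>))) * indicator (space M) x \<partial>M)"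
    by (intro Chernoff_ineq_nn_integral_ge \<open>l > 0\<close>) auto
  also have "\<dots> \<le> ennreal (exp (- l * \<epsilon>))
      * (\<integral>\<^sup>+x. (\<Sum>s\<in>S. ennreal (1 / c) * ennreal (exp (l * (V s x - \<mu>)))) \<partial>M)"
  proof (intro mult_left_mono nn_integral_mono)
    fix x assume "x \<in> space M"
    have "(\<Sum>s\<in>S. ennreal (1 / c) * ennreal (exp (l * (V s x - \<mu>))))
        = ennreal ((\<Sum>s\<in>S. exp (l * (V s x - \<mu>))) / c)"
      using pos by (simp add: sum_divide_distrib sum_ennreal flip: ennreal_mult')
    with jensen[of x] show "ennreal (exp (l * ((\<Sum>s\<in>S. V s x) / c - \<mu>))) * indicator (space M) x
        \<le> (\<Sum>s\<in>S. ennreal (1 / c) * ennreal (exp (l * (V s x - \<mu>))))"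
      by (auto intro!: ennreal_leI split: split_indicator)
  qed auto
  also have "(\<integral>\<^sup>+x. (\<Sum>s\<in>S. ennreal (1 / c) * ennreal (exp (l * (V s x - \<mu>)))) \<partial>M)
      = (\<Sum>s\<in>S. ennreal (1 / c) * (\<integral>\<^sup>+x. ennreal (exp (l * (V s x - \<mu>))) \<partial>M))"
    by (subst nn_integral_sum) (auto intro!: sum.cong nn_integral_cmult)
  also have "\<dots> \<le> (\<Sum>s\<in>S. ennreal (1 / c) * ennreal (exp (l\<^sup>2 * d\<^sup>2 / (8 * m))))"
    by (intro sum_mono mult_left_mono mgf) auto
  also have "\<dots> = ennreal (exp (l\<^sup>2 * d\<^sup>2 / (8 * m)))"
    using pos by (simp add: c_def ennreal_of_nat_eq_real_of_nat flip: ennreal_mult')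
  also have "ennreal (exp (- l * \<epsilon>)) * \<dots> = ennreal (exp (l\<^sup>2 * d\<^sup>2 / (8 * m) - l * \<epsilon>))"
    by (simp add: exp_diff exp_minus field_simps flip: ennreal_mult')
  also have "l\<^sup>2 * d\<^sup>2 / (8 * m) - l * \<epsilon> = - 2 * m * \<epsilon>\<^sup>2 / d\<^sup>2"
    using pos by (simp add: l_def field_simps power2_eq_square)
  finally show ?thesis
    by (simp add: mult_left_mono m_def d_def)
qed

section \<open>Sums over permutations and over distinct quadruples\<close>

lemma sum_Diff_permutes:
  assumes "p permutes I"
  shows "(\<Sum>j\<in>I - p ` A. f j) = (\<Sum>j\<in>I - A. f (p j))"
proof -
  have "I - p ` A = p ` (I - A)"
    using assms by (metis image_set_diff permutes_image permutes_inj)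
  then show ?thesis
    using assms by (simp add: sum.reindex permutes_inj_on)
qed

text \<open>The removed sets are written as explicit enumerations because nested sums over distinct
  indices exclude earlier indices in exactly this form.\<close>

lemma sum_Diff_permutes_insert:
  assumes "p permutes I"
  shows "(\<Sum>j\<in>I - {p a}. f j) = (\<Sum>j\<in>I - {a}. f (p j))"
    "(\<Sum>j\<in>I - {p a, p b}. f j) = (\<Sum>j\<in>I - {a, b}. f (p j))"
    "(\<Sum>j\<in>I - {p a, p b, p c}. f j) = (\<Sum>j\<in>I - {a, b, c}. f (p j))"
  using sum_Diff_permutes[OF assms, of f "{a}"] sum_Diff_permutes[OF assms, of f "{a, b}"]
    sum_Diff_permutes[OF assms, of f "{a, b, c}"] by simp_all

text \<open>The complements of the two images in \<open>I\<close> have equal size, so any bijection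
  between them can be glued to \<open>g\<close> after the inverse of \<open>f\<close>. Outside
  \<open>I\<close> the result is the identity, as \<open>permutes\<close> demands.\<close>

lemma permutes_extend_inj:
  assumes "finite I" "inj_on f K" "inj_on g K" "f ` K \<subseteq> I" "g ` K \<subseteq> I"
  obtains p where "p permutes I" "\<And>k. k \<in> K \<Longrightarrow> p (f k) = g k"
proof -
  have "card (I - f ` K) = card (I - g ` K)"
    using assms by (metis card_Diff_subset card_image finite_subset)
  then obtain q where q: "bij_betw q (I - f ` K) (I - g ` K)"
    using finite_same_card_bij[of "I - f ` K" "I - g ` K"] assms(1) by auto
  define p where "p i = (if i \<in> f ` K then g (inv_into K f i) else if i \<in> I then q i else i)" for i
  have "bij_betw (\<lambda>i. g (inv_into K f i)) (f ` K) (g ` K)"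
    using bij_betw_trans[OF bij_betw_inv_into[OF inj_on_imp_bij_betw[OF assms(2)]]
        inj_on_imp_bij_betw[OF assms(3)]] by (simp add: comp_def)
  then have "bij_betw p (f ` K) (g ` K)"
    by (rule bij_betw_cong[THEN iffD1, rotated]) (simp add: p_def)
  moreover have "bij_betw p (I - f ` K) (I - g ` K)"
    using q by (rule bij_betw_cong[THEN iffD1, rotated]) (simp add: p_def)
  ultimately have "bij_betw p (f ` K \<union> (I - f ` K)) (g ` K \<union> (I - g ` K))"
    by (intro bij_betw_combine) auto
  moreover have "f ` K \<union> (I - f ` K) = I" "g ` K \<union> (I - g ` K) = I"
    using assms by auto
  ultimately have "p permutes I"
    using assms(4) by (intro bij_imp_permutes) (auto simp: p_def)
  moreover have "p (f k) = g k" if "k \<in> K" for k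
    using that assms(2) by (simp add: p_def)
  ultimately show ?thesis using that by blast
qed

text \<open>Right multiplication by a permutation taking \<open>f\<close> to \<open>g\<close> is a
  bijection of the symmetric group, so the choice of reference tuple is immaterial. The restriction
  to \<open>K\<close> hides from \<open>F\<close> all values off \<open>K\<close>, about which
  nothing is known.\<close>

lemma sum_permutations_transfer:
  assumes "finite I" "inj_on f K" "inj_on g K" "f ` K \<subseteq> I" "g ` K \<subseteq> I"
  shows "(\<Sum>p | p permutes I. F (\<lambda>k\<in>K. p (f k))) = (\<Sum>p | p permutes I. F (\<lambda>k\<in>K. p (g k)))"
proof -
  obtain q where q: "q permutes I" "\<And>k. k \<in> K \<Longrightarrow> q (f k) = g k"
    using permutes_extend_inj[OF assms] by metis
  have eq: "(\<lambda>k\<in>K. (p \<circ> q) (f k)) = (\<lambda>k\<in>K. p (g k))" for p :: "'a \<Rightarrow> 'a"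
    by (auto simp: q(2))
  have "(\<Sum>p | p permutes I. F (\<lambda>k\<in>K. p (f k))) = (\<Sum>p | p permutes I. F (\<lambda>k\<in>K. (p \<circ> q) (f k)))"
    by (rule sum_permutations_compose_right[OF q(1)])
  then show ?thesis unfolding eq .
qed

lemma sum_permutations_transfer4:
  assumes "finite I" "distinct [a, b, c, d]" "distinct [a', b', c', d']"
    "{a, b, c, d, a', b', c', d'} \<subseteq> I"
  shows "(\<Sum>p | p permutes I. F (p a) (p b) (p c) (p d))
       = (\<Sum>p | p permutes I. F (p a') (p b') (p c') (p d'))"
proof -
  let ?K = "{..<4::nat}"
  have K: "?K = {0, 1, 2, 3}" by auto
  have inj: "inj_on ((!) xs) ?K" if "distinct xs" "length xs = 4" for xs :: "'a list"
    using that inj_on_nth by fastforce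
  show ?thesis
    using sum_permutations_transfer[of I "(!) [a, b, c, d]" ?K "(!) [a', b', c', d']"
        "\<lambda>w. F (w 0) (w 1) (w 2) (w 3)"] inj[of "[a, b, c, d]"] inj[of "[a', b', c', d']"] assms
    unfolding K by (simp add: numeral_eq_Suc)
qed

text \<open>Double counting: relabelling by any \<open>p\<close> leaves the nested sum unchanged, so
  it may be summed over all \<open>p\<close>. After exchanging the sums, every quadruple contributes
  what the reference quadruple does, and only the number of quadruples remains.\<close>

lemma sum_distinct4_eq_permutation_average:
  fixes F :: "'a \<Rightarrow> 'a \<Rightarrow> 'a \<Rightarrow> 'a \<Rightarrow> real"
  assumes I: "finite I" "card I = n" and d: "distinct [a, b, c, d]" "{a, b, c, d} \<subseteq> I"
  shows "(\<Sum>i\<in>I. \<Sum>j\<in>I - {i}. \<Sum>k\<in>I - {i, j}. \<Sum>l\<in>I - {i, j, k}. F i j k l)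
       = real n * (real n - 1) * (real n - 2) * (real n - 3) / fact n
         * (\<Sum>p | p permutes I. F (p a) (p b) (p c) (p d))"
proof -
  let ?P = "{p. p permutes I}"
  define s where "s = (\<lambda>F. \<Sum>i\<in>I. \<Sum>j\<in>I - {i}. \<Sum>k\<in>I - {i, j}. \<Sum>l\<in>I - {i, j, k}. (F i j k l :: real))"
  define m where "m = (\<Sum>p\<in>?P. F (p a) (p b) (p c) (p d))"
  have n: "n \<ge> 4"
    using card_mono[OF I(1) d(2)] d(1) I(2) by simp
  have inv: "s F = s (\<lambda>i j k l. F (p i) (p j) (p k) (p l))" if p: "p permutes I" for p
    unfolding s_def by (subst sum.permute[OF p]) (simp add: sum_Diff_permutes_insert[OF p] comp_def)
  have "fact n * s F = (\<Sum>p\<in>?P. s F)"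
    using card_permutations[OF I(2,1)] by simp
  also have "\<dots> = (\<Sum>p\<in>?P. s (\<lambda>i j k l. F (p i) (p j) (p k) (p l)))"
    by (rule sum.cong) (auto intro: inv)
  also have "\<dots> = s (\<lambda>i j k l. \<Sum>p\<in>?P. F (p i) (p j) (p k) (p l))"
    unfolding s_def by (simp only: sum.swap[of _ _ ?P])
  also have "\<dots> = s (\<lambda>i j k l. m)"
    unfolding s_def m_def using d
    by (intro sum.cong refl sum_permutations_transfer4[OF I(1)]) auto
  also have "\<dots> = real n * (real n - 1) * (real n - 2) * (real n - 3) * m"
  proof -
    \<comment> \<open>The number of admissible values drops by one with each index already chosen;
      \<open>n \<ge> 4\<close> lets natural subtraction agree with real subtraction.\<close>
    have "(\<Sum>l\<in>I - {i, j, k}. m) = (real n - 3) * m" if "i \<in> I" "j \<in> I - {i}" "k \<in> I - {i, j}" for i j k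
      using that I n by (auto simp: card_Diff_subset of_nat_diff card_insert_if)
    moreover have "(\<Sum>k\<in>I - {i, j}. (real n - 3) * m) = (real n - 2) * ((real n - 3) * m)"
      if "i \<in> I" "j \<in> I - {i}" for i j
      using that I n by (auto simp: card_Diff_subset of_nat_diff card_insert_if)
    moreover have "(\<Sum>j\<in>I - {i}. (real n - 2) * ((real n - 3) * m))
        = (real n - 1) * ((real n - 2) * ((real n - 3) * m))" if "i \<in> I" for i
      using that I n by (auto simp: card_Diff_subset of_nat_diff card_insert_if)
    ultimately show ?thesis
      unfolding s_def using I by (simp del: sum_constant) simp
  qed
  finally show ?thesis
    by (simp add: s_def m_def field_simps)
qed

section \<open>Algebra of the U-centered estimator\<close>

lemma sum_Diff_insert:
  fixes f :: "'a \<Rightarrow> real"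
  assumes "finite I" "i \<in> I"
  shows "sum f (I - {i}) = sum f I - f i"
    and "j \<in> I - {i} \<Longrightarrow> sum f (I - {i, j}) = sum f I - f i - f j"
    and "j \<in> I - {i} \<Longrightarrow> k \<in> I - {i, j} \<Longrightarrow> sum f (I - {i, j, k}) = sum f I - f i - f j - f k"
  using assms by (auto simp: sum_diff)

text \<open>Reduces the estimator to entrywise products, products of row sums and the product of
  totals, the normal form in which it is later compared with the sum over distinct
  quadruples.\<close>

lemma u_centered_cross_sum:
  fixes A B :: "nat \<Rightarrow> nat \<Rightarrow> real"
  assumes n: "n \<ge> 3"
    and A: "\<And>i j. A i j = A j i" "\<And>i. A i i = 0"
    and B: "\<And>i j. B i j = B j i" "\<And>i. B i i = 0"
  defines "I \<equiv> {1..n}"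
  shows "(\<Sum>i\<in>I. \<Sum>j\<in>I - {i}. u_centered n A i j * u_centered n B i j)
       = (\<Sum>i\<in>I. \<Sum>j\<in>I. A i j * B i j)
         - 2 / (real n - 2) * (\<Sum>i\<in>I. (\<Sum>j\<in>I. A i j) * (\<Sum>j\<in>I. B i j))
         + 1 / ((real n - 1) * (real n - 2)) * (\<Sum>i\<in>I. \<Sum>j\<in>I. A i j) * (\<Sum>i\<in>I. \<Sum>j\<in>I. B i j)"
proof -
  define c where "c = 1 / (real n - 2)"
  define e where "e = 1 / ((real n - 1) * (real n - 2))"
  define R where "R = (\<lambda>C (i :: nat). \<Sum>j\<in>I. C i j :: real)"
  define T where "T = (\<lambda>C. \<Sum>i\<in>I. R C i)"
  have fin: "finite I" and const: "(\<Sum>i\<in>I. t) = real n * t" for t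
    by (auto simp: I_def)
  have R_row: "sum (C i) I = R C i" for C i
    by (simp add: R_def)
  have u: "u_centered n C i j = (if i = j then 0 else C i j - c * R C i - c * R C j + e * T C)"
    if "\<And>i j. C i j = C j i" for C i j
    using that[of _ j] by (simp add: u_centered_def R_def T_def c_def e_def I_def)
  \<comment> \<open>As U-centering kills row sums, only the raw entries of \<open>B\<close> survive in the cross sum.\<close>
  have row: "(\<Sum>j\<in>I. u_centered n A i j) = 0" if "i \<in> I" for i
  proof -
    have "(\<Sum>j\<in>I. u_centered n A i j) = (\<Sum>j\<in>I - {i}. A i j - c * R A i - c * R A j + e * T A)"
      using that fin by (simp add: sum.remove u[OF A(1)])
    \<comment> \<open>The subtracted bracket is the \<open>j = i\<close> term, where
      \<open>A i i = 0\<close>. What remains has coefficients \<open>1 - (n - 2) * c\<close> at the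
      row sum and \<open>(n - 1) * e - c\<close> at the total; the values of \<open>c\<close> and
      \<open>e\<close> are the ones that make both vanish.\<close>
    also have "\<dots> = (R A i - n * c * R A i - c * T A + n * e * T A) - (- 2 * c * R A i + e * T A)"
      using that fin A(2)
      by (simp add: sum_Diff_insert sum.distrib sum_subtractf const R_row T_def algebra_simps
          del: sum_constant flip: sum_distrib_left)
    also have "\<dots> = 0"
      using n by (simp add: c_def e_def divide_simps) (simp add: algebra_simps)
    finally show ?thesis .
  qed
  have sym: "u_centered n A i j = u_centered n A j i" for i j
    using A(1)[of i j] by (simp add: u[OF A(1)])
  \<comment> \<open>As \<open>u_centered n A i i = 0\<close>, the diagonal can be restored and the
    off-diagonal formula for \<open>B\<close> used there too.\<close>
  have "(\<Sum>i\<in>I. \<Sum>j\<in>I - {i}. u_centered n A i j * u_centered n B i j)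
      = (\<Sum>i\<in>I. \<Sum>j\<in>I. u_centered n A i j * (B i j - c * R B i - c * R B j + e * T B))"
  proof (rule sum.cong[OF refl])
    fix i assume "i \<in> I"
    then show "(\<Sum>j\<in>I - {i}. u_centered n A i j * u_centered n B i j)
        = (\<Sum>j\<in>I. u_centered n A i j * (B i j - c * R B i - c * R B j + e * T B))"
      unfolding sum.remove[OF fin \<open>i \<in> I\<close>] by (simp add: u[OF A(1)] u[OF B(1)])
  qed
  also have "\<dots> = (\<Sum>i\<in>I. \<Sum>j\<in>I. u_centered n A i j * B i j)
      - c * (\<Sum>i\<in>I. R B i * (\<Sum>j\<in>I. u_centered n A i j))
      - c * (\<Sum>i\<in>I. \<Sum>j\<in>I. R B j * u_centered n A i j)
      + e * T B * (\<Sum>i\<in>I. \<Sum>j\<in>I. u_centered n A i j)"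
    by (simp add: sum_distrib_left sum_subtractf sum.distrib algebra_simps)
  also have "(\<Sum>i\<in>I. \<Sum>j\<in>I. R B j * u_centered n A i j) = (\<Sum>i\<in>I. R B i * (\<Sum>j\<in>I. u_centered n A i j))"
    by (subst sum.swap) (simp add: sym sum_distrib_left)
  \<comment> \<open>The roles are reversed: now \<open>B i i = 0\<close> permits the off-diagonal
    formula for \<open>A\<close> on the diagonal.\<close>
  also have "(\<Sum>i\<in>I. \<Sum>j\<in>I. u_centered n A i j * B i j)
      = (\<Sum>i\<in>I. \<Sum>j\<in>I. (A i j - c * R A i - c * R A j + e * T A) * B i j)"
    by (intro sum.cong refl) (simp add: u[OF A(1)] B(2))
  also have "\<dots> = (\<Sum>i\<in>I. \<Sum>j\<in>I. A i j * B i j) - c * (\<Sum>i\<in>I. R A i * R B i)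
      - c * (\<Sum>i\<in>I. \<Sum>j\<in>I. R A j * B i j) + e * T A * T B"
    by (simp add: left_diff_distrib distrib_right mult.assoc sum_subtractf sum.distrib R_row
        T_def flip: sum_distrib_left)
  also have "(\<Sum>i\<in>I. \<Sum>j\<in>I. R A j * B i j) = (\<Sum>i\<in>I. R A i * R B i)"
  proof -
    have "(\<Sum>i\<in>I. B i j) = R B j" for j
      unfolding R_def by (intro sum.cong refl B(1))
    then show ?thesis
      by (subst sum.swap) (simp flip: sum_distrib_left)
  qed
  finally show ?thesis
    by (simp add: row) (simp add: R_def T_def c_def e_def)
qed

text \<open>Inclusion-exclusion, one summand of \<open>h\<close> at a time. For
  \<open>A i j * B i j\<close> the indices \<open>k\<close>, \<open>l\<close> are free. For
  \<open>A i j * B k l\<close>, the total \<open>T\<close> loses \<open>4 * (S - P)\<close> for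
  pairs sharing exactly one index and \<open>2 * P\<close> for equal pairs. For
  \<open>A i j * B i k\<close> the sum over \<open>j \<noteq> k\<close> is \<open>S - P\<close>, and
  \<open>l\<close> is free.\<close>

lemma sum_distinct4_cross:
  fixes A B :: "nat \<Rightarrow> nat \<Rightarrow> real" and n :: nat
  assumes A: "\<And>i j. A i j = A j i" "\<And>i. A i i = 0"
    and B: "\<And>i j. B i j = B j i" "\<And>i. B i i = 0"
  defines "I \<equiv> {1..n}"
  defines "P \<equiv> \<Sum>i\<in>I. \<Sum>j\<in>I. A i j * B i j"
    and "S \<equiv> \<Sum>i\<in>I. (\<Sum>j\<in>I. A i j) * (\<Sum>j\<in>I. B i j)"
    and "T \<equiv> (\<Sum>i\<in>I. \<Sum>j\<in>I. A i j) * (\<Sum>i\<in>I. \<Sum>j\<in>I. B i j)"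
  shows "(\<Sum>i\<in>I. \<Sum>j\<in>I - {i}. \<Sum>k\<in>I - {i, j}. \<Sum>l\<in>I - {i, j, k}.
            A i j * B i j + A i j * B k l - 2 * (A i j * B i k))
       = (real n - 2) * (real n - 3) * P + (T - 4 * S + 2 * P) - 2 * (real n - 3) * (S - P)"
proof -
  define RA where "RA = (\<lambda>i. \<Sum>j\<in>I. A i j)"
  define RB where "RB = (\<lambda>i. \<Sum>j\<in>I. B i j)"
  define TB where "TB = (\<Sum>i\<in>I. RB i)"
  have fin: "finite I" and const: "(\<Sum>i\<in>I. t) = real n * t" for t
    by (auto simp: I_def)
  have col: "(\<Sum>k\<in>I. B k i) = RB i" for i
    unfolding RB_def by (intro sum.cong refl B(1))
  have row: "sum (B i) I = RB i" for i
    by (simp add: RB_def)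
  \<comment> \<open>The indices are eliminated from the inside out; each restricted sum is the full
    sum minus the excluded terms, among which diagonal entries vanish.\<close>
  have l: "(\<Sum>l\<in>I - {i, j, k}. A i j * B i j + A i j * B k l - 2 * (A i j * B i k))
      = A i j * ((real n - 3) * B i j + RB k - B k i - B k j - 2 * (real n - 3) * B i k)"
    if "i \<in> I" "j \<in> I - {i}" "k \<in> I - {i, j}" for i j k
    using that fin B(2)
    by (simp add: sum_Diff_insert sum.distrib sum_subtractf RB_def const algebra_simps
        del: sum_constant flip: sum_distrib_left)
  have k: "(\<Sum>k\<in>I - {i, j}.
        A i j * ((real n - 3) * B i j + RB k - B k i - B k j - 2 * (real n - 3) * B i k))
      = A i j * ((real n - 2) * (real n - 3) * B i j
                 + (TB - 2 * RB i - 2 * RB j + 2 * B i j) - 2 * (real n - 3) * (RB i - B i j))"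
    if "i \<in> I" "j \<in> I - {i}" for i j
  proof -
    have eq: "(\<Sum>k\<in>I - {i, j}. ((real n - 3) * B i j + RB k - B k i - B k j - 2 * (real n - 3) * B i k))
      = n * ((real n - 3) * B i j) + TB - RB i - RB j - 2 * (real n - 3) * RB i
        - ((real n - 3) * B i j + RB i - B i j)
        - ((real n - 3) * B i j + RB j - B i j - 2 * (real n - 3) * B i j)"
      using that fin B(2) B(1)[of j i]
      by (simp add: sum_Diff_insert sum.distrib sum_subtractf TB_def col row const
          del: sum_constant flip: sum_distrib_left) (simp add: algebra_simps)
    show ?thesis
      unfolding sum_distrib_left[symmetric] eq by (simp add: algebra_simps)
  qed
  have j: "(\<Sum>j\<in>I - {i}. A i j * ((real n - 2) * (real n - 3) * B i j
                 + (TB - 2 * RB i - 2 * RB j + 2 * B i j) - 2 * (real n - 3) * (RB i - B i j)))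
      = (real n - 2) * (real n - 3) * (\<Sum>j\<in>I. A i j * B i j)
        + (RA i * TB - 2 * (RA i * RB i) - 2 * (\<Sum>j\<in>I. A i j * RB j) + 2 * (\<Sum>j\<in>I. A i j * B i j))
        - 2 * (real n - 3) * (RA i * RB i - (\<Sum>j\<in>I. A i j * B i j))" if "i \<in> I" for i
  proof -
    have "A i j * ((real n - 2) * (real n - 3) * B i j
                 + (TB - 2 * RB i - 2 * RB j + 2 * B i j) - 2 * (real n - 3) * (RB i - B i j))
        = ((real n - 2) * (real n - 3) + 2 + 2 * (real n - 3)) * (A i j * B i j)
          + (TB - 2 * RB i - 2 * (real n - 3) * RB i) * A i j - 2 * (A i j * RB j)" for j
      by (simp add: algebra_simps)
    \<comment> \<open>The excluded term \<open>j = i\<close> carries the factor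
      \<open>A i i = 0\<close>, so the sum may run over all of \<open>I\<close>.\<close>
    then have "?thesis \<longleftrightarrow>
      (\<Sum>j\<in>I. ((real n - 2) * (real n - 3) + 2 + 2 * (real n - 3)) * (A i j * B i j)
          + (TB - 2 * RB i - 2 * (real n - 3) * RB i) * A i j - 2 * (A i j * RB j))
      = ((real n - 2) * (real n - 3) + 2 + 2 * (real n - 3)) * (\<Sum>j\<in>I. A i j * B i j)
        + (TB - 2 * RB i - 2 * (real n - 3) * RB i) * RA i - 2 * (\<Sum>j\<in>I. A i j * RB j)"
      using that fin A(2) by (simp add: sum_Diff_insert) (simp add: algebra_simps)
    then show ?thesis
      by (simp only: sum.distrib sum_subtractf sum_distrib_left RA_def)
  qed
  have swap: "(\<Sum>i\<in>I. \<Sum>j\<in>I. A i j * RB j) = (\<Sum>i\<in>I. RA i * RB i)"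
  proof -
    have "(\<Sum>i\<in>I. A i j) = RA j" for j
      unfolding RA_def by (intro sum.cong refl A(1))
    then show ?thesis
      by (subst sum.swap) (simp flip: sum_distrib_right)
  qed
  have T: "T = (\<Sum>i\<in>I. RA i) * TB" and S: "S = (\<Sum>i\<in>I. RA i * RB i)"
    by (simp_all add: T_def S_def RA_def RB_def TB_def)
  have "(\<Sum>i\<in>I. \<Sum>j\<in>I - {i}. \<Sum>k\<in>I - {i, j}. \<Sum>l\<in>I - {i, j, k}.
            A i j * B i j + A i j * B k l - 2 * (A i j * B i k))
      = (\<Sum>i\<in>I. \<Sum>j\<in>I - {i}. \<Sum>k\<in>I - {i, j}.
            A i j * ((real n - 3) * B i j + RB k - B k i - B k j - 2 * (real n - 3) * B i k))"
    by (intro sum.cong refl l)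
  also have "\<dots> = (\<Sum>i\<in>I. \<Sum>j\<in>I - {i}.
      A i j * ((real n - 2) * (real n - 3) * B i j
                 + (TB - 2 * RB i - 2 * RB j + 2 * B i j) - 2 * (real n - 3) * (RB i - B i j)))"
    by (intro sum.cong refl k)
  also have "\<dots> = (\<Sum>i\<in>I. (real n - 2) * (real n - 3) * (\<Sum>j\<in>I. A i j * B i j)
        + (RA i * TB - 2 * (RA i * RB i) - 2 * (\<Sum>j\<in>I. A i j * RB j) + 2 * (\<Sum>j\<in>I. A i j * B i j))
        - 2 * (real n - 3) * (RA i * RB i - (\<Sum>j\<in>I. A i j * B i j)))"
    by (intro sum.cong refl j)
  also have "\<dots> = (real n - 2) * (real n - 3) * P + (T - 4 * S + 2 * P) - 2 * (real n - 3) * (S - P)"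
    by (simp add: sum.distrib sum_subtractf swap T S P_def flip: sum_distrib_left sum_distrib_right)
  finally show ?thesis .
qed

text \<open>In the sum over distinct quadruples the coefficient of P is
  \<open>(n - 2) * (n - 3) + 2 + 2 * (n - 3) = (n - 1) * (n - 2)\<close> and that of S is
  \<open>- 2 * (n - 1)\<close>. Division by \<open>n * (n - 1) * (n - 2) * (n - 3)\<close> then
  yields the prefactor \<open>1 / (n * (n - 3))\<close> and the coefficients of the U-centered
  expansion.\<close>

lemma u_centered_estimator_eq_permutation_average:
  fixes A B :: "nat \<Rightarrow> nat \<Rightarrow> real"
  assumes n: "n \<ge> 4"
    and A: "\<And>i j. A i j = A j i" "\<And>i. A i i = 0"
    and B: "\<And>i j. B i j = B j i" "\<And>i. B i i = 0"
  shows "1 / (real n * (real n - 3)) *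
           (\<Sum>i=1..n. \<Sum>j\<in>{1..n} - {i}. u_centered n A i j * u_centered n B i j)
       = (\<Sum>p | p permutes {1..n}. A (p 1) (p 2) * B (p 1) (p 2) + A (p 1) (p 2) * B (p 3) (p 4)
            - 2 * (A (p 1) (p 2) * B (p 1) (p 3))) / fact n"
proof -
  define I where "I = {1..n}"
  define P where "P = (\<Sum>i\<in>I. \<Sum>j\<in>I. A i j * B i j)"
  define S where "S = (\<Sum>i\<in>I. (\<Sum>j\<in>I. A i j) * (\<Sum>j\<in>I. B i j))"
  define T where "T = (\<Sum>i\<in>I. \<Sum>j\<in>I. A i j) * (\<Sum>i\<in>I. \<Sum>j\<in>I. B i j)"
  define Q where "Q = (\<Sum>p | p permutes I. A (p 1) (p 2) * B (p 1) (p 2) + A (p 1) (p 2) * B (p 3) (p 4)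
            - 2 * (A (p 1) (p 2) * B (p 1) (p 3)))"
  have pos: "real n > 0" "real n - 1 > 0" "real n - 2 > 0" "real n - 3 > 0"
    using n by auto
  have "(real n - 2) * (real n - 3) * P + (T - 4 * S + 2 * P) - 2 * (real n - 3) * (S - P)
      = real n * (real n - 1) * (real n - 2) * (real n - 3) / fact n * Q"
    using sum_distinct4_eq_permutation_average[of I n 1 2 3 4
        "\<lambda>i j k l. A i j * B i j + A i j * B k l - 2 * (A i j * B i k)"]
      sum_distinct4_cross[OF A B, where n = n] n
    by (simp add: I_def P_def S_def T_def Q_def)
  then have "Q / fact n
      = ((real n - 2) * (real n - 3) * P + (T - 4 * S + 2 * P) - 2 * (real n - 3) * (S - P))
      / (real n * (real n - 1) * (real n - 2) * (real n - 3))"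
    using pos by (simp add: divide_simps mult_ac)
  also have "\<dots> = 1 / (real n * (real n - 3))
      * (P - 2 / (real n - 2) * S + 1 / ((real n - 1) * (real n - 2)) * T)"
    using pos by (simp add: divide_simps) (simp add: algebra_simps)
  finally show ?thesis
    using u_centered_cross_sum[OF _ A B, of n] n
    by (simp add: I_def P_def S_def T_def Q_def mult.assoc)
qed

section \<open>Hoeffding's inequality for U-statistics\<close>

text \<open>The joint law is a product of copies of \<open>D\<close>, and an injective reindexing of
  such a product is again one. Hence \<open>h\<close> has the same expectation on every block of
  every permuted sample.\<close>

lemma (in prob_space) distr_iid_subfamily:
  assumes indep: "indep_vars (\<lambda>_. S) z I" and ident: "\<And>i. i \<in> I \<Longrightarrow> distr M S (z i) = D"
    and f: "inj_on f K" "f ` K \<subseteq> I" and "I \<noteq> {}"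
  shows "distr M (\<Pi>\<^sub>M k\<in>K. S) (\<lambda>\<omega>. \<lambda>k\<in>K. z (f k) \<omega>) = (\<Pi>\<^sub>M k\<in>K. D)"
proof -
  have z[measurable]: "z i \<in> measurable M S" if "i \<in> I" for i
    using indep that by (auto simp: indep_vars_def)
  obtain i where i: "i \<in> I" using \<open>I \<noteq> {}\<close> by auto
  then have D: "prob_space D" "sets D = sets S"
    using ident[OF i] z prob_space_distr[OF z[OF i]] by auto
  have "distr M (\<Pi>\<^sub>M i\<in>I. S) (\<lambda>\<omega>. \<lambda>i\<in>I. z i \<omega>) = (\<Pi>\<^sub>M i\<in>I. distr M S (z i))"
    using indep_vars_iff_distr_eq_PiM'[where M' = "\<lambda>_. S" and X = z] indep \<open>I \<noteq> {}\<close> z by simp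
  also have "\<dots> = (\<Pi>\<^sub>M i\<in>I. D)"
    by (intro PiM_cong refl ident)
  finally have PiM: "(\<Pi>\<^sub>M i\<in>I. D) = distr M (\<Pi>\<^sub>M i\<in>I. S) (\<lambda>\<omega>. \<lambda>i\<in>I. z i \<omega>)" ..
  have sets: "sets (\<Pi>\<^sub>M k\<in>K. D) = sets (\<Pi>\<^sub>M k\<in>K. S)"
    by (intro sets_PiM_cong refl D)
  have reindex[measurable]: "(\<lambda>\<omega>. \<lambda>k\<in>K. \<omega> (f k)) \<in> measurable (\<Pi>\<^sub>M i\<in>I. S) (\<Pi>\<^sub>M k\<in>K. S)"
    using f by (intro measurable_restrict measurable_component_singleton) auto
  have "(\<Pi>\<^sub>M k\<in>K. D) = distr (\<Pi>\<^sub>M i\<in>I. D) (\<Pi>\<^sub>M k\<in>K. D) (\<lambda>\<omega>. \<lambda>k\<in>K. \<omega> (f k))"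
    using distr_PiM_reindex[of I "\<lambda>_. D" f K] D f by (simp add: image_subset_iff_funcset)
  also have "\<dots> = distr (\<Pi>\<^sub>M i\<in>I. D) (\<Pi>\<^sub>M k\<in>K. S) (\<lambda>\<omega>. \<lambda>k\<in>K. \<omega> (f k))"
    by (rule distr_cong) (auto simp: sets)
  also have "\<dots> = distr M (\<Pi>\<^sub>M k\<in>K. S) ((\<lambda>\<omega>. \<lambda>k\<in>K. \<omega> (f k)) \<circ> (\<lambda>\<omega>. \<lambda>i\<in>I. z i \<omega>))"
    unfolding PiM by (intro distr_distr reindex measurable_restrict z)
  also have "(\<lambda>\<omega>. \<lambda>k\<in>K. \<omega> (f k)) \<circ> (\<lambda>\<omega>. \<lambda>i\<in>I. z i \<omega>) = (\<lambda>\<omega>. \<lambda>k\<in>K. z (f k) \<omega>)"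
    using f by (auto simp: fun_eq_iff)
  finally show ?thesis ..
qed

text \<open>The map \<open>f\<close> only names a reference tuple at which the permutations are
  evaluated; the blocks of the proof are different tuples, exchanged for \<open>f\<close> by
  \<open>sum_permutations_transfer\<close>.\<close>

theorem (in prob_space) Hoeffding_U_statistic:
  fixes z :: "'i \<Rightarrow> 'a \<Rightarrow> 'b" and h :: "(nat \<Rightarrow> 'b) \<Rightarrow> real" and a b \<epsilon> :: real
  assumes indep: "indep_vars (\<lambda>_. S) z I" and ident: "\<And>i. i \<in> I \<Longrightarrow> distr M S (z i) = D"
    and I: "finite I" and r: "0 < r" "r \<le> card I"
    and h: "h \<in> borel_measurable (\<Pi>\<^sub>M k\<in>{..<r}. S)"
    and bnd: "\<And>w. w \<in> space (\<Pi>\<^sub>M k\<in>{..<r}. S) \<Longrightarrow> h w \<in> {a..b}"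
    and f: "inj_on f {..<r}" "f ` {..<r} \<subseteq> I"
    and "\<epsilon> > 0" "a < b"
  shows "prob {\<omega> \<in> space M. (\<Sum>p | p permutes I. h (\<lambda>k\<in>{..<r}. z (p (f k)) \<omega>)) / fact (card I)
             \<ge> expectation (\<lambda>\<omega>. h (\<lambda>k\<in>{..<r}. z (f k) \<omega>)) + \<epsilon>}
           \<le> exp (- 2 * real (card I div r) * \<epsilon>\<^sup>2 / (b - a)\<^sup>2)"
proof -
  define m where "m = card I div r"
  define P where "P = {p. p permutes I}"
  have "I \<noteq> {}" and m: "m > 0"
    using r by (auto simp: m_def div_greater_zero_iff)
  obtain e where e: "bij_betw e {..<card I} I"
    using ex_bij_betw_nat_finite[OF I] by (auto simp: atLeast0LessThan)
  \<comment> \<open>Slot \<open>k\<close> of block \<open>j\<close> in the enumeration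
    \<open>e\<close>; dividing the position by \<open>r\<close> recovers \<open>j\<close>, so blocks
    are disjoint. The \<open>card I mod r\<close> leftover positions lie in no block, but
    permutations move every observation through the blocks.\<close>
  define g where "g = (\<lambda>j k. e (r * j + k))"
  have lt: "r * j + k < card I" if "j < m" "k < r" for j k
  proof -
    have "r * j + k < r * Suc j" using that by simp
    also have "\<dots> \<le> r * m" using that by (intro mult_le_mono) auto
    also have "\<dots> \<le> card I" by (simp add: m_def)
    finally show ?thesis .
  qed
  have g_eq: "j = j' \<and> k = k'"
    if "g j k = g j' k'" "j < m" "j' < m" "k < r" "k' < r" for j k j' k'
  proof -
    have eq: "r * j + k = r * j' + k'"
      using that lt e by (auto simp: g_def bij_betw_def inj_on_def)
    have "(r * j + k) div r = j" "(r * j' + k') div r = j'"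
      using that by auto
    with eq show ?thesis by simp
  qed
  have g: "inj_on (g j) {..<r}" "g j ` {..<r} \<subseteq> I" if "j < m" for j
    using that lt[OF that] e g_eq[of j _ j] by (auto simp: inj_on_def g_def bij_betw_def)
  have pg: "inj_on (p \<circ> g j) {..<r}" "(p \<circ> g j) ` {..<r} \<subseteq> I" if "p \<in> P" "j < m" for p j
  proof -
    show "inj_on (p \<circ> g j) {..<r}"
      using g(1)[OF that(2)] that(1) by (auto intro: comp_inj_on permutes_inj_on simp: P_def)
    show "(p \<circ> g j) ` {..<r} \<subseteq> I"
      using g(2)[OF that(2)] permutes_in_image[of p I] that(1) by (auto simp: P_def)
  qed
  define W where "W = (\<lambda>p j \<omega>. h (\<lambda>k\<in>{..<r}. z (p (g j k)) \<omega>))"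
  have z[measurable]: "z i \<in> measurable M S" if "i \<in> I" for i
    using indep that by (auto simp: indep_vars_def)
  have sub: "(\<lambda>\<omega>. \<lambda>k\<in>{..<r}. z (q k) \<omega>) \<in> measurable M (\<Pi>\<^sub>M k\<in>{..<r}. S)" if "q ` {..<r} \<subseteq> I" for q
    using that by (intro measurable_restrict z) auto
  have E: "expectation (\<lambda>\<omega>. h (\<lambda>k\<in>{..<r}. z (q k) \<omega>)) = integral\<^sup>L (\<Pi>\<^sub>M k\<in>{..<r}. D) h"
    if "inj_on q {..<r}" "q ` {..<r} \<subseteq> I" for q
    using distr_iid_subfamily[OF indep ident that \<open>I \<noteq> {}\<close>] integral_distr[OF sub[OF that(2)] h] by simp
  \<comment> \<open>For a fixed \<open>p\<close> the blocks occupy disjoint index sets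
    \<open>K j\<close>, and \<open>W p j\<close> reads only the observations in \<open>K j\<close>.
    For different \<open>p\<close> the values are dependent.\<close>
  have indep_W: "indep_vars (\<lambda>_. borel) (W p) {..<m}" if p: "p \<in> P" for p
  proof -
    define K where "K = (\<lambda>j. (p \<circ> g j) ` {..<r})"
    define H where "H = (\<lambda>j w. h (\<lambda>k\<in>{..<r}. w (p (g j k))))"
    have "disjoint_family_on K {..<m}"
      unfolding disjoint_family_on_def
    proof (intro ballI impI)
      fix j j' assume j: "j \<in> {..<m}" "j' \<in> {..<m}" "j \<noteq> j'"
      have "inj p" using p by (auto simp: P_def intro: permutes_inj)
      then show "K j \<inter> K j' = {}"
        using j g_eq[of j _ j'] by (auto simp: K_def inj_eq)
    qed
    then have "indep_vars (\<lambda>j. PiM (K j) (\<lambda>_. S)) (\<lambda>j \<omega>. restrict (\<lambda>i. z i \<omega>) (K j)) {..<m}"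
      using pg(2)[OF p] by (intro indep_vars_restrict[OF indep]) (auto simp: K_def)
    then have "indep_vars (\<lambda>_. borel) (\<lambda>j \<omega>. H j (restrict (\<lambda>i. z i \<omega>) (K j))) {..<m}"
    proof (rule indep_vars_compose2)
      fix j assume "j \<in> {..<m}"
      have "(\<lambda>w. \<lambda>k\<in>{..<r}. w (p (g j k))) \<in> measurable (PiM (K j) (\<lambda>_. S)) (\<Pi>\<^sub>M k\<in>{..<r}. S)"
        by (intro measurable_restrict measurable_component_singleton) (auto simp: K_def)
      from measurable_compose[OF this h] show "H j \<in> borel_measurable (PiM (K j) (\<lambda>_. S))"
        by (simp add: H_def)
    qed
    moreover have "H j (restrict (\<lambda>i. z i \<omega>) (K j)) = W p j \<omega>" for j \<omega>
      unfolding H_def W_def by (rule arg_cong[where f = h]) (auto simp: K_def fun_eq_iff)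
    ultimately show ?thesis by simp
  qed
  \<comment> \<open>After exchanging the sums, each block \<open>j\<close> contributes the same sum
    over permutations as the reference tuple, so the mean over the \<open>m\<close> blocks
    collapses.\<close>
  have avg: "(\<Sum>p\<in>P. (\<Sum>j<m. W p j \<omega>) / card {..<m}) / card P
      = (\<Sum>p | p permutes I. h (\<lambda>k\<in>{..<r}. z (p (f k)) \<omega>)) / fact (card I)" for \<omega>
  proof -
    define F where "F = (\<lambda>w. h (\<lambda>k\<in>{..<r}. z (w k) \<omega>))"
    have F: "F (\<lambda>k\<in>{..<r}. p (q k)) = h (\<lambda>k\<in>{..<r}. z (p (q k)) \<omega>)" for p q
      unfolding F_def by (rule arg_cong[where f = h]) auto
    have "(\<Sum>p\<in>P. W p j \<omega>) = (\<Sum>p\<in>P. h (\<lambda>k\<in>{..<r}. z (p (f k)) \<omega>))" if "j < m" for j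
      using sum_permutations_transfer[OF I g(1)[OF that] f(1) g(2)[OF that] f(2), of F]
      by (simp add: W_def F P_def)
    then have "(\<Sum>p\<in>P. \<Sum>j<m. W p j \<omega>) = m * (\<Sum>p\<in>P. h (\<lambda>k\<in>{..<r}. z (p (f k)) \<omega>))"
      by (subst sum.swap) simp
    then show ?thesis
      using m card_permutations[OF refl I] by (simp add: P_def flip: sum_divide_distrib)
  qed
  have "prob {\<omega> \<in> space M. (\<Sum>p\<in>P. (\<Sum>j<m. W p j \<omega>) / card {..<m}) / card P
             \<ge> expectation (\<lambda>\<omega>. h (\<lambda>k\<in>{..<r}. z (f k) \<omega>)) + \<epsilon>}
           \<le> exp (- 2 * card {..<m} * \<epsilon>\<^sup>2 / (b - a)\<^sup>2)"
  proof (rule Hoeffding_ineq_average)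
    show "finite P" "P \<noteq> {}" "finite {..<m}" "{..<m} \<noteq> {}"
      using I m by (auto simp: P_def finite_permutations intro!: exI[of _ id])
    fix p j assume p: "p \<in> P" and "j \<in> {..<m}"
    then have j: "j < m" by simp
    show "AE \<omega> in M. W p j \<omega> \<in> {a..b}"
      using measurable_space[OF sub[OF pg(2)[OF p j]]]
      by (intro AE_I2) (auto simp: W_def intro!: bnd[simplified])
    show "expectation (W p j) = expectation (\<lambda>\<omega>. h (\<lambda>k\<in>{..<r}. z (f k) \<omega>))"
      using E[OF pg[OF p j]] E[OF f] by (simp add: W_def)
  qed (use indep_W \<open>\<epsilon> > 0\<close> \<open>a < b\<close> in auto)
  then show ?thesis
    unfolding avg by (simp add: m_def)
qed

section \<open>Expectation of the kernel under an iid sample\<close>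

lemma (in prob_space) indep_var_pair:
  assumes indep: "indep_vars (\<lambda>_. S) z I" and "i \<in> I" "j \<in> I" "i \<noteq> j"
  shows "indep_var S (z i) S (z j)"
proof -
  have "indep_var (PiM {i} (\<lambda>_. S)) (\<lambda>\<omega>. restrict (\<lambda>i. z i \<omega>) {i})
          (PiM {j} (\<lambda>_. S)) (\<lambda>\<omega>. restrict (\<lambda>i. z i \<omega>) {j})"
    using assms by (intro indep_var_restrict[OF indep]) auto
  from indep_var_compose[OF this measurable_component_singleton measurable_component_singleton, of i j]
  show ?thesis by (simp add: comp_def)
qed

text \<open>Only the two index sets must be disjoint: a pair may repeat an index, which covers a
  single observation against a pair.\<close>

lemma (in prob_space) indep_var_pair_pair:
  assumes indep: "indep_vars (\<lambda>_. S) z I" and "{i, j, k, l} \<subseteq> I" "{i, j} \<inter> {k, l} = {}"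
  shows "indep_var (S \<Otimes>\<^sub>M S) (\<lambda>\<omega>. (z i \<omega>, z j \<omega>)) (S \<Otimes>\<^sub>M S) (\<lambda>\<omega>. (z k \<omega>, z l \<omega>))"
proof -
  have meas: "(\<lambda>w. (w a, w b)) \<in> measurable (PiM {a, b} (\<lambda>_. S)) (S \<Otimes>\<^sub>M S)" for a b
    by (intro measurable_Pair measurable_component_singleton) auto
  have "indep_var (PiM {i, j} (\<lambda>_. S)) (\<lambda>\<omega>. restrict (\<lambda>i. z i \<omega>) {i, j})
          (PiM {k, l} (\<lambda>_. S)) (\<lambda>\<omega>. restrict (\<lambda>i. z i \<omega>) {k, l})"
    using assms by (intro indep_var_restrict[OF indep]) auto
  from indep_var_compose[OF this meas meas]
  show ?thesis by (simp add: comp_def)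
qed

lemma (in prob_space) iid_pair_distr:
  assumes indep: "indep_vars (\<lambda>_. S) z I" and ident: "\<And>i. i \<in> I \<Longrightarrow> distr M S (z i) = D"
    and ij: "i \<in> I" "j \<in> I" "i \<noteq> j"
  shows "distr M (S \<Otimes>\<^sub>M S) (\<lambda>\<omega>. (z i \<omega>, z j \<omega>)) = D \<Otimes>\<^sub>M D"
  using indep_var_pair[OF indep ij] ident ij by (simp add: indep_var_distribution_eq)

text \<open>A common pair integrates over its joint law, and disjoint pairs factor by independence.
  Pairs sharing \<open>z i\<close> factor only once \<open>z i\<close> is frozen, whence the product
  of inner integrals. Both functions take whole observations, since the two components of an
  observation may be dependent.\<close>

lemma (in prob_space) expectation_iid_cross:
  fixes \<alpha> \<beta> :: "'b \<times> 'b \<Rightarrow> real"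
  assumes indep: "indep_vars (\<lambda>_. S) z I" and ident: "\<And>i. i \<in> I \<Longrightarrow> distr M S (z i) = D"
    and ijkl: "{i, j, k, l} \<subseteq> I" "distinct [i, j, k, l]"
    and \<alpha>: "\<alpha> \<in> borel_measurable (S \<Otimes>\<^sub>M S)" "\<And>s. \<bar>\<alpha> s\<bar> \<le> c"
    and \<beta>: "\<beta> \<in> borel_measurable (S \<Otimes>\<^sub>M S)" "\<And>s. \<bar>\<beta> s\<bar> \<le> d"
  shows "expectation (\<lambda>\<omega>. \<alpha> (z i \<omega>, z j \<omega>) * \<beta> (z i \<omega>, z j \<omega>) + \<alpha> (z i \<omega>, z j \<omega>) * \<beta> (z k \<omega>, z l \<omega>)
             - 2 * (\<alpha> (z i \<omega>, z j \<omega>) * \<beta> (z i \<omega>, z k \<omega>)))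
       = (\<integral>s. \<alpha> s * \<beta> s \<partial>(D \<Otimes>\<^sub>M D)) + (\<integral>s. \<alpha> s \<partial>(D \<Otimes>\<^sub>M D)) * (\<integral>s. \<beta> s \<partial>(D \<Otimes>\<^sub>M D))
         - 2 * (\<integral>s. (\<integral>t. \<alpha> (s, t) \<partial>D) * (\<integral>t. \<beta> (s, t) \<partial>D) \<partial>D)"
proof -
  have z[measurable]: "z i \<in> measurable M S" if "i \<in> I" for i
    using indep that by (auto simp: indep_vars_def)
  note zs[measurable] = z[of i] z[of j] z[of k] z[of l]
  have I[simp]: "i \<in> I" "j \<in> I" "k \<in> I" "l \<in> I" using ijkl by auto
  note [measurable] = \<alpha>(1) \<beta>(1)
  have D: "prob_space D" "sets D = sets S"
    using ident[of i] prob_space_distr[OF z[of i]] by auto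
  note [measurable_cong] = D(2)
  interpret D: prob_space D by (rule D)
  interpret DD: pair_prob_space D D ..
  \<comment> \<open>Evaluating the bounds at an arbitrary point shows that they are
    nonnegative.\<close>
  have "c \<ge> 0" "d \<ge> 0" using \<alpha>(2)[of undefined] \<beta>(2)[of undefined] by linarith+
  then have prod: "\<bar>\<alpha> s * \<beta> t\<bar> \<le> c * d" for s t
    unfolding abs_mult by (intro mult_mono \<alpha>(2) \<beta>(2)) auto
  have "expectation (\<lambda>\<omega>. \<alpha> (z i \<omega>, z j \<omega>) * \<beta> (z i \<omega>, z j \<omega>))
      = (\<integral>s. \<alpha> s * \<beta> s \<partial>distr M (S \<Otimes>\<^sub>M S) (\<lambda>\<omega>. (z i \<omega>, z j \<omega>)))"
    by (subst integral_distr) auto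
  also have "\<dots> = (\<integral>s. \<alpha> s * \<beta> s \<partial>(D \<Otimes>\<^sub>M D))"
    using ijkl by (subst iid_pair_distr[OF indep ident]) auto
  finally have 1: "expectation (\<lambda>\<omega>. \<alpha> (z i \<omega>, z j \<omega>) * \<beta> (z i \<omega>, z j \<omega>)) = \<dots>" .
  have single: "expectation (\<lambda>\<omega>. f (z i \<omega>, z j \<omega>)) = (\<integral>s. f s \<partial>(D \<Otimes>\<^sub>M D))"
    if "f \<in> borel_measurable (S \<Otimes>\<^sub>M S)" "i \<in> I" "j \<in> I" "i \<noteq> j" for f :: "'b \<times> 'b \<Rightarrow> real" and i j
    using that iid_pair_distr[OF indep ident that(2-4)]
      integral_distr[of "\<lambda>\<omega>. (z i \<omega>, z j \<omega>)" M "S \<Otimes>\<^sub>M S" f] z by simp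
  have "indep_var borel (\<alpha> \<circ> (\<lambda>\<omega>. (z i \<omega>, z j \<omega>))) borel (\<beta> \<circ> (\<lambda>\<omega>. (z k \<omega>, z l \<omega>)))"
    using indep_var_compose[OF indep_var_pair_pair[OF indep ijkl(1)] \<alpha>(1) \<beta>(1)] ijkl(2) by auto
  then have "expectation (\<lambda>\<omega>. \<alpha> (z i \<omega>, z j \<omega>) * \<beta> (z k \<omega>, z l \<omega>))
      = expectation (\<lambda>\<omega>. \<alpha> (z i \<omega>, z j \<omega>)) * expectation (\<lambda>\<omega>. \<beta> (z k \<omega>, z l \<omega>))"
    using integrable_const_bound[of "\<lambda>\<omega>. \<alpha> (z i \<omega>, z j \<omega>)" c] \<alpha>(2)
      integrable_const_bound[of "\<lambda>\<omega>. \<beta> (z k \<omega>, z l \<omega>)" d] \<beta>(2)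
    by (subst indep_var_lebesgue_integral[symmetric]) (simp_all add: comp_def)
  then have 2: "expectation (\<lambda>\<omega>. \<alpha> (z i \<omega>, z j \<omega>) * \<beta> (z k \<omega>, z l \<omega>))
      = (\<integral>s. \<alpha> s \<partial>(D \<Otimes>\<^sub>M D)) * (\<integral>s. \<beta> s \<partial>(D \<Otimes>\<^sub>M D))"
    using ijkl by (simp add: single)
  let ?G = "\<lambda>s. (\<integral>t. \<alpha> (s, t) \<partial>D) * (\<integral>t. \<beta> (s, t) \<partial>D)"
  \<comment> \<open>\<open>indep_var\<close> relates variables of the same type only, so \<open>z i\<close> enters as the pair \<open>(z i, z i)\<close>.\<close>
  let ?E = "distr M (S \<Otimes>\<^sub>M S) (\<lambda>\<omega>. (z i \<omega>, z i \<omega>))"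
  interpret E: prob_space ?E by (rule prob_space_distr) measurable
  interpret ED: pair_prob_space ?E "D \<Otimes>\<^sub>M D" ..
  have joint: "distr M ((S \<Otimes>\<^sub>M S) \<Otimes>\<^sub>M (S \<Otimes>\<^sub>M S)) (\<lambda>\<omega>. ((z i \<omega>, z i \<omega>), (z j \<omega>, z k \<omega>)))
      = ?E \<Otimes>\<^sub>M (D \<Otimes>\<^sub>M D)"
    using indep_var_pair_pair[OF indep, of i i j k] iid_pair_distr[OF indep ident, of j k] ijkl
    by (auto simp: indep_var_distribution_eq)
  have "expectation (\<lambda>\<omega>. \<alpha> (z i \<omega>, z j \<omega>) * \<beta> (z i \<omega>, z k \<omega>))
      = (\<integral>v. \<alpha> (fst (fst v), fst (snd v)) * \<beta> (fst (fst v), snd (snd v)) \<partial>(?E \<Otimes>\<^sub>M (D \<Otimes>\<^sub>M D)))"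
    unfolding joint[symmetric] by (subst integral_distr) auto
  also have "\<dots> = (\<integral>v. (\<integral>w. \<alpha> (fst v, fst w) * \<beta> (fst v, snd w) \<partial>(D \<Otimes>\<^sub>M D)) \<partial>?E)"
    using prod by (subst ED.integral_fst'[symmetric])
      (auto intro!: ED.P.integrable_const_bound[of _ "c * d"])
  \<comment> \<open>With the shared observation fixed, a second use of Fubini separates the two
    remaining ones.\<close>
  also have "\<dots> = (\<integral>v. ?G (fst v) \<partial>?E)"
  proof (intro Bochner_Integration.integral_cong refl)
    fix v assume "v \<in> space ?E"
    then have s[measurable]: "fst v \<in> space S" by (auto simp: space_pair_measure)
    have "(\<integral>w. \<alpha> (fst v, fst w) * \<beta> (fst v, snd w) \<partial>(D \<Otimes>\<^sub>M D))
        = (\<integral>t. (\<integral>u. \<alpha> (fst v, t) * \<beta> (fst v, u) \<partial>D) \<partial>D)"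
      using prod by (subst DD.integral_fst'[symmetric])
        (auto intro!: DD.P.integrable_const_bound[of _ "c * d"])
    then show "(\<integral>w. \<alpha> (fst v, fst w) * \<beta> (fst v, snd w) \<partial>(D \<Otimes>\<^sub>M D)) = ?G (fst v)"
      by simp
  qed
  also have "\<dots> = expectation (\<lambda>\<omega>. ?G (z i \<omega>))"
    by (subst integral_distr) auto
  also have "\<dots> = (\<integral>s. ?G s \<partial>distr M S (z i))"
    by (subst integral_distr) auto
  also have "\<dots> = (\<integral>s. ?G s \<partial>D)"
    by (simp add: ident)
  finally have 3: "expectation (\<lambda>\<omega>. \<alpha> (z i \<omega>, z j \<omega>) * \<beta> (z i \<omega>, z k \<omega>)) = \<dots>" .
  have int: "integrable M (\<lambda>\<omega>. \<alpha> (z i \<omega>, z j \<omega>) * \<beta> (z i' \<omega>, z j' \<omega>))" if "i' \<in> I" "j' \<in> I" for i' j'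
    using that prod by (intro integrable_const_bound[of _ "c * d"]) auto
  show ?thesis
    by (simp add: int 1 2 3)
qed

section \<open>Kernel distances and the law of the pair\<close>

text \<open>Second countability identifies the Borel sets of the product space with the product
  sigma-algebra, so joint continuity gives the joint measurability that Fubini needs.\<close>

lemma kernel_dist_borel_measurable:
  fixes \<kappa> :: "'a::second_countable_topology \<Rightarrow> 'a \<Rightarrow> real"
  assumes "mercer_kernel \<kappa>"
  shows "(\<lambda>(s, t). kernel_dist \<kappa> s t) \<in> borel_measurable (borel \<Otimes>\<^sub>M borel)"
proof -
  have [measurable]: "case_prod \<kappa> \<in> borel_measurable (borel \<Otimes>\<^sub>M borel)"
    using assms unfolding borel_prod mercer_kernel_def
    by (intro borel_measurable_continuous_onI) simp
  show ?thesis
    unfolding kernel_dist_def by measurable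
qed

lemma kernel_dist_prod_borel_measurable:
  fixes \<kappa>X :: "'a::second_countable_topology \<Rightarrow> 'a \<Rightarrow> real"
    and \<kappa>Y :: "'b::second_countable_topology \<Rightarrow> 'b \<Rightarrow> real"
  assumes "mercer_kernel \<kappa>X" "mercer_kernel \<kappa>Y"
  shows "(\<lambda>(s, t). kernel_dist \<kappa>X (fst s) (fst t))
           \<in> borel_measurable ((borel :: ('a \<times> 'b) measure) \<Otimes>\<^sub>M (borel :: ('a \<times> 'b) measure))"
    and "(\<lambda>(s, t). kernel_dist \<kappa>Y (snd s) (snd t))
           \<in> borel_measurable ((borel :: ('a \<times> 'b) measure) \<Otimes>\<^sub>M (borel :: ('a \<times> 'b) measure))"
proof -
  have "(\<lambda>p. (\<lambda>(s, t). kernel_dist \<kappa>X s t) (fst (fst p), fst (snd p))) \<in> borel_measurable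
      (((borel :: 'a measure) \<Otimes>\<^sub>M (borel :: 'b measure)) \<Otimes>\<^sub>M (borel \<Otimes>\<^sub>M borel))"
    by (rule measurable_compose[OF _ kernel_dist_borel_measurable[OF assms(1)]]) measurable
  then show "(\<lambda>(s, t). kernel_dist \<kappa>X (fst s) (fst t))
      \<in> borel_measurable ((borel :: ('a \<times> 'b) measure) \<Otimes>\<^sub>M (borel :: ('a \<times> 'b) measure))"
    by (simp add: split_beta' flip: borel_prod)
  have "(\<lambda>p. (\<lambda>(s, t). kernel_dist \<kappa>Y s t) (snd (fst p), snd (snd p))) \<in> borel_measurable
      (((borel :: 'a measure) \<Otimes>\<^sub>M (borel :: 'b measure)) \<Otimes>\<^sub>M (borel \<Otimes>\<^sub>M borel))"
    by (rule measurable_compose[OF _ kernel_dist_borel_measurable[OF assms(2)]]) measurable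
  then show "(\<lambda>(s, t). kernel_dist \<kappa>Y (snd s) (snd t))
      \<in> borel_measurable ((borel :: ('a \<times> 'b) measure) \<Otimes>\<^sub>M (borel :: ('a \<times> 'b) measure))"
    by (simp add: split_beta' flip: borel_prod)
qed

text \<open>The population lives on \<open>M\<close> and the sample on another space; only the law
  \<open>D\<close> links them. Written through \<open>D\<close>, dCov matches the expectation
  computed from the sample.\<close>

lemma dCov_eq_distr:
  fixes \<kappa>X :: "'a::second_countable_topology \<Rightarrow> 'a \<Rightarrow> real"
    and \<kappa>Y :: "'b::second_countable_topology \<Rightarrow> 'b \<Rightarrow> real"
  assumes "prob_space M" and X[measurable]: "X \<in> borel_measurable M"
    and Y[measurable]: "Y \<in> borel_measurable M"
    and "mercer_kernel \<kappa>X" "mercer_kernel \<kappa>Y"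
  defines "D \<equiv> distr M borel (\<lambda>\<omega>. (X \<omega>, Y \<omega>))"
    and "\<alpha> \<equiv> \<lambda>(s, t). kernel_dist \<kappa>X (fst s) (fst t)"
    and "\<beta> \<equiv> \<lambda>(s, t). kernel_dist \<kappa>Y (snd s) (snd t)"
  shows "dCov M \<kappa>X \<kappa>Y X Y
       = (\<integral>s. \<alpha> s * \<beta> s \<partial>(D \<Otimes>\<^sub>M D)) + (\<integral>s. \<alpha> s \<partial>(D \<Otimes>\<^sub>M D)) * (\<integral>s. \<beta> s \<partial>(D \<Otimes>\<^sub>M D))
         - 2 * (\<integral>s. (\<integral>t. \<alpha> (s, t) \<partial>D) * (\<integral>t. \<beta> (s, t) \<partial>D) \<partial>D)"
proof -
  interpret prob_space M by fact
  have XY[measurable]: "(\<lambda>\<omega>. (X \<omega>, Y \<omega>)) \<in> borel_measurable M"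
    by (subst borel_prod[symmetric]) measurable
  have D: "prob_space D" unfolding D_def by (rule prob_space_distr) (rule XY)
  note [measurable] = kernel_dist_prod_borel_measurable[OF assms(4,5), folded \<alpha>_def \<beta>_def]
  interpret D: prob_space D by (rule D)
  have [measurable_cong]: "sets D = sets borel" by (simp add: D_def)
  have DD: "D \<Otimes>\<^sub>M D = distr (M \<Otimes>\<^sub>M M) (borel \<Otimes>\<^sub>M borel) (\<lambda>(v, w). ((X v, Y v), (X w, Y w)))"
    unfolding D_def using D.sigma_finite_measure_axioms
    by (intro pair_measure_distr XY) (simp add: D_def)
  have pair: "(\<integral>s. f s \<partial>(D \<Otimes>\<^sub>M D)) = (LINT (v, w)|(M \<Otimes>\<^sub>M M). f ((X v, Y v), (X w, Y w)))"
    if "f \<in> borel_measurable (borel \<Otimes>\<^sub>M borel)" for f :: "('a \<times> 'b) \<times> ('a \<times> 'b) \<Rightarrow> real"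
    unfolding DD by (subst integral_distr) (use that in \<open>auto simp: split_beta'\<close>)
  have inner: "(\<integral>t. f (s, t) \<partial>D) = (LINT w|M. f (s, (X w, Y w)))"
    if "f \<in> borel_measurable (borel \<Otimes>\<^sub>M borel)" for f :: "('a \<times> 'b) \<times> ('a \<times> 'b) \<Rightarrow> real" and s
    unfolding D_def using that by (subst integral_distr) auto
  have "(\<integral>s. (\<integral>t. \<alpha> (s, t) \<partial>D) * (\<integral>t. \<beta> (s, t) \<partial>D) \<partial>D)
      = (LINT v|M. (\<integral>t. \<alpha> ((X v, Y v), t) \<partial>D) * (\<integral>t. \<beta> ((X v, Y v), t) \<partial>D))"
    unfolding D_def
    by (subst integral_distr) (auto simp flip: D_def)
  then show ?thesis
    by (simp add: dCov_def pair inner) (simp add: \<alpha>_def \<beta>_def)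
qed

lemma kernel_dist_commute: "mercer_kernel \<kappa> \<Longrightarrow> kernel_dist \<kappa> s t = kernel_dist \<kappa> t s"
  by (auto simp: mercer_kernel_def kernel_dist_def add.commute)

lemma kernel_dist_self [simp]: "kernel_dist \<kappa> s s = 0"
  by (simp add: kernel_dist_def)

section \<open>The two tail bounds\<close>

theorem theorem8:
  fixes M :: "'w measure" and N :: "'v measure"
    and X :: "'w \<Rightarrow> real ^ 'q" and Y :: "'w \<Rightarrow> real ^ 'p"
    and x :: "nat \<Rightarrow> 'v \<Rightarrow> real ^ 'q" and y :: "nat \<Rightarrow> 'v \<Rightarrow> real ^ 'p"
    and \<kappa>X :: "real ^ 'q \<Rightarrow> real ^ 'q \<Rightarrow> real" and \<kappa>Y :: "real ^ 'p \<Rightarrow> real ^ 'p \<Rightarrow> real"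
    and n :: nat and \<epsilon> :: real
  assumes "prob_space M" and "X \<in> borel_measurable M" and "Y \<in> borel_measurable M"
    and "prob_space N"
    and indep: "prob_space.indep_vars N (\<lambda>_. borel) (\<lambda>i \<omega>. (x i \<omega>, y i \<omega>)) {1..n}"
    and ident: "\<And>i. i \<in> {1..n} \<Longrightarrow>
      distr N borel (\<lambda>\<omega>. (x i \<omega>, y i \<omega>)) = distr M borel (\<lambda>\<omega>. (X \<omega>, Y \<omega>))"
    and "n \<ge> 4"
    and "mercer_kernel \<kappa>X" and "mercer_kernel \<kappa>Y"
    and "\<And>s t. kernel_dist \<kappa>X s t \<in> {0..<1}" and "\<And>s t. kernel_dist \<kappa>Y s t \<in> {0..<1}"
    and "\<epsilon> > 0"
  shows "\<P>(\<omega> in N. dCov_est n \<kappa>X \<kappa>Y (\<lambda>i. x i \<omega>) (\<lambda>i. y i \<omega>) - dCov M \<kappa>X \<kappa>Y X Y \<ge> \<epsilon>)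
           \<le> exp (- real n * \<epsilon>\<^sup>2 / 512)
       \<and> \<P>(\<omega> in N. dCov M \<kappa>X \<kappa>Y X Y - dCov_est n \<kappa>X \<kappa>Y (\<lambda>i. x i \<omega>) (\<lambda>i. y i \<omega>) \<ge> \<epsilon>)
           \<le> exp (- real n * \<epsilon>\<^sup>2 / 512)"
proof -
  interpret N: prob_space N by fact
  let ?D = "distr M borel (\<lambda>\<omega>. (X \<omega>, Y \<omega>))"
  let ?S = "borel :: ((real ^ 'q) \<times> (real ^ 'p)) measure"
  define I where "I = {1..n}"
  define z where "z = (\<lambda>i \<omega>. (x i \<omega>, y i \<omega>))"
  define \<alpha> :: "((real ^ 'q) \<times> (real ^ 'p)) \<times> ((real ^ 'q) \<times> (real ^ 'p)) \<Rightarrow> real"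
    where "\<alpha> = (\<lambda>(s, t). kernel_dist \<kappa>X (fst s) (fst t))"
  define \<beta> :: "((real ^ 'q) \<times> (real ^ 'p)) \<times> ((real ^ 'q) \<times> (real ^ 'p)) \<Rightarrow> real"
    where "\<beta> = (\<lambda>(s, t). kernel_dist \<kappa>Y (snd s) (snd t))"
  define h where "h = (\<lambda>w :: nat \<Rightarrow> _. \<alpha> (w 0, w 1) * \<beta> (w 0, w 1) + \<alpha> (w 0, w 1) * \<beta> (w 2, w 3)
      - 2 * (\<alpha> (w 0, w 1) * \<beta> (w 0, w 2)))"
  define \<theta> where "\<theta> = dCov M \<kappa>X \<kappa>Y X Y"
  define U where "U = (\<lambda>\<omega>. dCov_est n \<kappa>X \<kappa>Y (\<lambda>i. x i \<omega>) (\<lambda>i. y i \<omega>))"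
  have indep: "N.indep_vars (\<lambda>_. ?S) z I"
    using indep by (simp add: z_def I_def)
  have ident: "distr N ?S (z i) = ?D" if "i \<in> I" for i
    using ident that by (simp add: z_def I_def)
  have \<alpha>: "\<alpha> \<in> borel_measurable (?S \<Otimes>\<^sub>M ?S)" and \<beta>: "\<beta> \<in> borel_measurable (?S \<Otimes>\<^sub>M ?S)"
    using kernel_dist_prod_borel_measurable[OF assms(8,9)] by (simp_all add: \<alpha>_def \<beta>_def)
  note [measurable] = \<alpha> \<beta>
  have \<alpha>01: "0 \<le> \<alpha> s" "\<alpha> s \<le> 1" and \<beta>01: "0 \<le> \<beta> s" "\<beta> s \<le> 1" for s
    using assms(10)[of "fst (fst s)" "fst (snd s)"] assms(11)[of "snd (fst s)" "snd (snd s)"]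
    by (auto simp: \<alpha>_def \<beta>_def split_beta')
  \<comment> \<open>The reference tuple is \<open>Suc\<close> because sample indices start at 1
    while the arguments of \<open>h\<close> start at 0.\<close>
  have f: "inj_on Suc {..<4}" "Suc ` {..<4} \<subseteq> I"
    using assms(7) by (auto simp: I_def)
  have h_sub: "h (\<lambda>k\<in>{..<4}. z (p (Suc k)) \<omega>)
      = kernel_dist \<kappa>X (x (p 1) \<omega>) (x (p 2) \<omega>) * kernel_dist \<kappa>Y (y (p 1) \<omega>) (y (p 2) \<omega>)
      + kernel_dist \<kappa>X (x (p 1) \<omega>) (x (p 2) \<omega>) * kernel_dist \<kappa>Y (y (p 3) \<omega>) (y (p 4) \<omega>)
      - 2 * (kernel_dist \<kappa>X (x (p 1) \<omega>) (x (p 2) \<omega>) * kernel_dist \<kappa>Y (y (p 1) \<omega>) (y (p 3) \<omega>))"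
    for p \<omega>
    by (simp add: h_def \<alpha>_def \<beta>_def z_def eval_nat_numeral)
  have U: "U \<omega> = (\<Sum>p | p permutes I. h (\<lambda>k\<in>{..<4}. z (p (Suc k)) \<omega>)) / fact (card I)" for \<omega>
    unfolding U_def dCov_est_def h_sub
    using u_centered_estimator_eq_permutation_average[of n "\<lambda>i j. kernel_dist \<kappa>X (x i \<omega>) (x j \<omega>)"
        "\<lambda>i j. kernel_dist \<kappa>Y (y i \<omega>) (y j \<omega>)"] assms(7-9)
    by (simp add: I_def kernel_dist_commute)
  have mean: "N.expectation (\<lambda>\<omega>. h (\<lambda>k\<in>{..<4}. z (Suc k) \<omega>)) = \<theta>"
    using N.expectation_iid_cross[OF indep ident, where i = 1 and j = 2 and k = 3 and l = 4
        and \<alpha> = \<alpha> and \<beta> = \<beta> and c = 1 and d = 1]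
      dCov_eq_distr[OF assms(1-3,8,9)] assms(7) \<alpha> \<beta> \<alpha>01 \<beta>01
    by (simp add: h_def \<theta>_def \<alpha>_def \<beta>_def I_def eval_nat_numeral)
  have h: "h \<in> borel_measurable (\<Pi>\<^sub>M k\<in>{..<4}. ?S)"
    unfolding h_def by measurable
  have bnd: "h w \<in> {-2..2}" for w
  proof -
    \<comment> \<open>All three terms share this factor, which lies in \<open>[0, 1]\<close>; the
      bracket lies in \<open>[-2, 2]\<close>. Bounding the terms separately would only give
      \<open>[-2, 3]\<close> or the like.\<close>
    have "h w = \<alpha> (w 0, w 1) * (\<beta> (w 0, w 1) + \<beta> (w 2, w 3) - 2 * \<beta> (w 0, w 2))"
      by (simp add: h_def algebra_simps)
    moreover have "\<bar>\<alpha> (w 0, w 1) * (\<beta> (w 0, w 1) + \<beta> (w 2, w 3) - 2 * \<beta> (w 0, w 2))\<bar> \<le> 1 * 2"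
      unfolding abs_mult using \<alpha>01[of "(w 0, w 1)"] \<beta>01[of "(w 0, w 1)"]
        \<beta>01[of "(w 2, w 3)"] \<beta>01[of "(w 0, w 2)"]
      by (intro mult_mono) auto
    ultimately show ?thesis by (auto simp: abs_le_iff)
  qed
  have bnd': "- h w \<in> {-2..2}" for w
    using bnd[of w] by auto
  have rate: "exp (- 2 * real (card I div 4) * \<epsilon>\<^sup>2 / (2 - - 2)\<^sup>2) \<le> exp (- real n * \<epsilon>\<^sup>2 / 512)"
  proof -
    \<comment> \<open>The exponent obtained is \<open>(n div 4) / 8\<close> times
      \<open>\<epsilon>\<^sup>2\<close>, up to sign, and \<open>512 = 8 * 64\<close>.\<close>
    have "n \<le> 64 * (n div 4)" using assms(7) by linarith
    then have "real n \<le> 64 * real (n div 4)" by (simp flip: of_nat_mult)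
    then have "real n * \<epsilon>\<^sup>2 \<le> (64 * real (n div 4)) * \<epsilon>\<^sup>2" by (rule mult_right_mono) simp
    then show ?thesis by (simp add: I_def mult_ac)
  qed
  have r: "finite I" "0 < (4 :: nat)" "4 \<le> card I"
    using assms(7) by (auto simp: I_def)
  have "N.prob {\<omega> \<in> space N. U \<omega> \<ge> \<theta> + \<epsilon>} \<le> exp (- 2 * real (card I div 4) * \<epsilon>\<^sup>2 / (2 - - 2)\<^sup>2)"
    using N.Hoeffding_U_statistic[OF indep ident r h _ f \<open>\<epsilon> > 0\<close>, of "-2" 2] bnd
    by (simp add: mean flip: U)
  \<comment> \<open>The lower tail is the upper tail for the kernel \<open>- h\<close>, which has
    mean \<open>- \<theta>\<close> and the same symmetric range.\<close>
  moreover have "N.prob {\<omega> \<in> space N. - U \<omega> \<ge> - \<theta> + \<epsilon>}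
      \<le> exp (- 2 * real (card I div 4) * \<epsilon>\<^sup>2 / (2 - - 2)\<^sup>2)"
    using N.Hoeffding_U_statistic[OF indep ident r borel_measurable_uminus[OF h] _ f \<open>\<epsilon> > 0\<close>,
        of "-2" 2] bnd'
    by (simp add: mean sum_negf flip: U)
  moreover have "{\<omega> \<in> space N. U \<omega> \<ge> \<theta> + \<epsilon>} = {\<omega> \<in> space N. U \<omega> - \<theta> \<ge> \<epsilon>}"
    "{\<omega> \<in> space N. - U \<omega> \<ge> - \<theta> + \<epsilon>} = {\<omega> \<in> space N. \<theta> - U \<omega> \<ge> \<epsilon>}"
    by auto
  ultimately show ?thesis
    using rate unfolding U_def \<theta>_def by (auto intro: order_trans)
qed

end
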